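(* Every expansion of $(\mathbb{R},<,\mathbb{N})$ that is PCC, CC or QCC defines the divisibility relation $\{(n,dn) : n,d\in\mathbb{N}\}$ on $\mathbb{N}$.
   Context: $\mathbb{N}$ is the set of nonnegative integers. All structures are first-order structures with underlying set $\mathbb{R}$. "Definable" means definable with parameters; definable sets are subsets of $\mathbb{R}^n$ for arbitrary $n$. Each $\mathbb{R}^n$ has its usual topology and subsets carry the subspace topology. A structure on $\mathbb{R}$ is PCC (path-component closed) if for every definable set $E$, each path component of $E$ is definable; it is CC (component closed) if for every definable set $E$, each connected component of $E$ is definable; it is QCC (quasicomponent closed) if for every definable set $E$, each quasicomponent of $E$ is definable. (The quasicomponent of a point $x$ in a space $E$ is the intersection of all clopen subsets of $E$ containing $x$.) *)

theory Defs
  imports "HOL-Analysis.Analysis"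
begin

section \<open>First-order structures with underlying set the real line\<close>

datatype 'f fo_term = Var nat | Fun 'f "'f fo_term list"

datatype ('f, 'r) fo_formula =
    Eq "'f fo_term" "'f fo_term"
  | Rel 'r "'f fo_term list"
  | Neg "('f, 'r) fo_formula"
  | Conj "('f, 'r) fo_formula" "('f, 'r) fo_formula"
  | Ex nat "('f, 'r) fo_formula"

text \<open>
  The sets of symbols may be empty or proper subsets of the symbol types, so that an arbitrary
  first-order language is allowed. Constants are function symbols of arity 0. The interpretations
  are only ever consulted at argument lists of the right length.
\<close>

record ('f, 'r) real_structure =
  fun_syms :: "'f set"
  rel_syms :: "'r set"
  fun_arity :: "'f \<Rightarrow> nat"
  rel_arity :: "'r \<Rightarrow> nat"
  fun_interp :: "'f \<Rightarrow> real list \<Rightarrow> real"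
  rel_interp :: "'r \<Rightarrow> real list \<Rightarrow> bool"

primrec wf_term :: "('f, 'r) real_structure \<Rightarrow> 'f fo_term \<Rightarrow> bool" where
  "wf_term M (Var i) \<longleftrightarrow> True"
| "wf_term M (Fun f ts) \<longleftrightarrow>
     f \<in> fun_syms M \<and> length ts = fun_arity M f \<and> list_all (wf_term M) ts"

primrec wf_formula :: "('f, 'r) real_structure \<Rightarrow> ('f, 'r) fo_formula \<Rightarrow> bool" where
  "wf_formula M (Eq s t) \<longleftrightarrow> wf_term M s \<and> wf_term M t"
| "wf_formula M (Rel r ts) \<longleftrightarrow>
     r \<in> rel_syms M \<and> length ts = rel_arity M r \<and> list_all (wf_term M) ts"
| "wf_formula M (Neg \<phi>) \<longleftrightarrow> wf_formula M \<phi>"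
| "wf_formula M (Conj \<phi> \<psi>) \<longleftrightarrow> wf_formula M \<phi> \<and> wf_formula M \<psi>"
| "wf_formula M (Ex i \<phi>) \<longleftrightarrow> wf_formula M \<phi>"

primrec term_val :: "('f, 'r) real_structure \<Rightarrow> (nat \<Rightarrow> real) \<Rightarrow> 'f fo_term \<Rightarrow> real" where
  "term_val M v (Var i) = v i"
| "term_val M v (Fun f ts) = fun_interp M f (map (term_val M v) ts)"

primrec satisfies ::
  "('f, 'r) real_structure \<Rightarrow> (nat \<Rightarrow> real) \<Rightarrow> ('f, 'r) fo_formula \<Rightarrow> bool" where
  "satisfies M v (Eq s t) \<longleftrightarrow> term_val M v s = term_val M v t"
| "satisfies M v (Rel r ts) \<longleftrightarrow> rel_interp M r (map (term_val M v) ts)"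
| "satisfies M v (Neg \<phi>) \<longleftrightarrow> \<not> satisfies M v \<phi>"
| "satisfies M v (Conj \<phi> \<psi>) \<longleftrightarrow> satisfies M v \<phi> \<and> satisfies M v \<psi>"
| "satisfies M v (Ex i \<phi>) \<longleftrightarrow> (\<exists>a. satisfies M (v(i := a)) \<phi>)"

text \<open>
  The structure has a symbol for the order and a symbol for the set of natural numbers (0 included).
\<close>

definition expands_order_nat :: "('f, 'r) real_structure \<Rightarrow> bool" where
  "expands_order_nat M \<longleftrightarrow>
     (\<exists>r \<in> rel_syms M. rel_arity M r = 2 \<and> (\<forall>x y. rel_interp M r [x, y] \<longleftrightarrow> x < y)) \<and>
     (\<exists>s \<in> rel_syms M. rel_arity M s = 1 \<and> (\<forall>x. rel_interp M s [x] \<longleftrightarrow> x \<in> \<nat>))"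


section \<open>Definable sets\<close>

text \<open>
  Real \<open>n\<close>-space is the library's \<^const>\<open>Euclidean_space\<close> \<open>n\<close>: functions \<open>nat \<Rightarrow> real\<close> vanishing
  at all indices \<open>\<ge> n\<close>, with the product topology. Coordinate \<open>i < n\<close> is assigned to variable \<open>i\<close>;
  variable \<open>n + k\<close> carries the parameter \<open>c k\<close>. Although \<open>c\<close> is an infinite sequence, only finitely many of its terms
  matter, as a formula has finitely many variables.
\<close>

definition definable :: "('f, 'r) real_structure \<Rightarrow> nat \<Rightarrow> (nat \<Rightarrow> real) set \<Rightarrow> bool" where
  "definable M n E \<longleftrightarrow>
     (\<exists>\<phi> c. wf_formula M \<phi> \<and>
        E = {x \<in> topspace (Euclidean_space n).
               satisfies M (\<lambda>i. if i < n then x i else c (i - n)) \<phi>})"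

text \<open>The point of real \<open>n\<close>-space with the given list of \<open>n\<close> coordinates.\<close>

definition tuple :: "real list \<Rightarrow> nat \<Rightarrow> real" where
  "tuple xs = (\<lambda>i. if i < length xs then xs ! i else 0)"


section \<open>Closure under taking components\<close>

definition PCC :: "('f, 'r) real_structure \<Rightarrow> bool" where
  "PCC M \<longleftrightarrow>
     (\<forall>n E. definable M n E \<longrightarrow>
        (\<forall>C \<in> path_components_of (subtopology (Euclidean_space n) E). definable M n C))"

definition CC :: "('f, 'r) real_structure \<Rightarrow> bool" where
  "CC M \<longleftrightarrow>
     (\<forall>n E. definable M n E \<longrightarrow>
        (\<forall>C \<in> connected_components_of (subtopology (Euclidean_space n) E). definable M n C))"

text \<open>
  By the fact \<open>quasi_component_of_set\<close>, the library's quasicomponent of a point is the intersection of the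
  clopen sets containing it.
\<close>

definition QCC :: "('f, 'r) real_structure \<Rightarrow> bool" where
  "QCC M \<longleftrightarrow>
     (\<forall>n E. definable M n E \<longrightarrow>
        (\<forall>C \<in> quasi_components_of (subtopology (Euclidean_space n) E). definable M n C))"

end

theory Submission
  imports Defs
begin

text \<open>
  Replace each vertex \<open>v\<close> of a graph on \<open>\<nat>\<^sup>k\<close> by two slices \<open>{v} \<times> \<real>\<^sup>k \<times> {0}\<close> and
  \<open>\<real>\<^sup>k \<times> {v} \<times> {1}\<close>, and join them by a vertical segment over \<open>(v, w)\<close> whenever \<open>v = w\<close> or
  \<open>v \<rightarrow> w\<close> is an edge. The resulting space is definable from the graph, and its path components,
  connected components and quasicomponents all coincide with the components of the graph. Counting
  modulo \<open>n\<close> only needs the successor function and the order, so there is a graph on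
  \<open>\<nat>\<^sup>3\<close>, definable in \<open>(\<real>, <, \<nat>)\<close>, one of whose components encodes divisibility; the latter is then a
  fibre of a single component of a definable set.
\<close>

section \<open>A topological model of a graph on tuples of natural numbers\<close>

text \<open>The last of the \<open>2 * k + 1\<close> coordinates is the height. The reflexive
  closure adds a segment joining the two slices of each vertex.\<close>

definition graph_space :: "nat \<Rightarrow> (nat list \<times> nat list) set \<Rightarrow> (nat \<Rightarrow> real) set" where
  "graph_space k R =
     {tuple (map real v @ ys @ [0]) | v ys. length v = k \<and> length ys = k} \<union>
     {tuple (ys @ map real w @ [1]) | w ys. length w = k \<and> length ys = k} \<union>
     {tuple (map real v @ map real w @ [t]) | v w t.
        length v = k \<and> length w = k \<and> (v, w) \<in> R\<^sup>= \<and> 0 \<le> t \<and> t \<le> 1}"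

section \<open>Segments between points given by coordinate lists\<close>

text \<open>\<open>Euclidean_space n\<close> is itself a subspace of the product topology, which is
  the topology of the type \<open>nat \<Rightarrow> real\<close>, so the ambient dimension drops
  out.\<close>

lemma subtopology_Euclidean_space:
  assumes "E \<subseteq> topspace (Euclidean_space n)"
  shows "subtopology (Euclidean_space n) E = top_of_set E"
  using assms
  by (simp add: Euclidean_space_def subtopology_subtopology euclidean_product_topology inf_absorb2)

lemma tuple_in_Euclidean_space: "length xs = n \<Longrightarrow> tuple xs \<in> topspace (Euclidean_space n)"
  by (simp add: topspace_Euclidean_space tuple_def)

lemma path_component_of_family:
  fixes f :: "real \<Rightarrow> nat \<Rightarrow> real"
  assumes "\<And>i. continuous_on {0..1} (\<lambda>t. f t i)" and "\<And>t. 0 \<le> t \<Longrightarrow> t \<le> 1 \<Longrightarrow> f t \<in> E"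
  shows "path_component_of (top_of_set E) (f 0) (f 1)"
proof -
  have "continuous_on {0..1} f"
    using assms(1) by (intro continuous_on_coordinatewise_then_product) auto
  then have "pathin (top_of_set E) f"
    using assms(2) by (auto simp: pathin_def continuous_map_in_subtopology)
  then show ?thesis
    by (auto simp: path_component_of_def)
qed

text \<open>Interpolating on lists keeps a block shared by both endpoints visibly fixed, through
  \<open>map2_interpolate_same\<close>.\<close>

lemma path_component_of_segment:
  assumes "length xs = length ys"
    and "\<And>t. 0 \<le> t \<Longrightarrow> t \<le> 1 \<Longrightarrow> tuple (map2 (\<lambda>x y. (1 - t) * x + t * y) xs ys) \<in> E"
  shows "path_component_of (top_of_set E) (tuple xs) (tuple ys)"
proof -
  let ?f = "\<lambda>t i. (1 - t) * tuple xs i + t * tuple ys i"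
  have "?f t = tuple (map2 (\<lambda>x y. (1 - t) * x + t * y) xs ys)" for t
    using assms(1) by (auto simp: tuple_def)
  then have "path_component_of (top_of_set E) (?f 0) (?f 1)"
    using assms(2) by (intro path_component_of_family continuous_intros) auto
  then show ?thesis
    by simp
qed

lemma map2_interpolate_same: "map2 (\<lambda>x y. (1 - t) * x + t * y) xs xs = xs" for t :: real
  by (simp add: zip_same_conv_map o_def algebra_simps)

lemma
  shows bottom_in_graph_space:
      "length v = k \<Longrightarrow> length ys = k \<Longrightarrow> tuple (map real v @ ys @ [0]) \<in> graph_space k R"
    and top_in_graph_space:
      "length w = k \<Longrightarrow> length ys = k \<Longrightarrow> tuple (ys @ map real w @ [1]) \<in> graph_space k R"
    and edge_in_graph_space:
      "length v = k \<Longrightarrow> length w = k \<Longrightarrow> (v, w) \<in> R\<^sup>= \<Longrightarrow> 0 \<le> t \<Longrightarrow> t \<le> 1 \<Longrightarrow>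
        tuple (map real v @ map real w @ [t]) \<in> graph_space k R"
  unfolding graph_space_def by blast+

section \<open>Paths following walks in the graph\<close>

text \<open>At height 0 the second block is arbitrary, so the slice is convex.\<close>

lemma graph_space_path_bottom:
  assumes "length v = k" "length ys = k" "length zs = k"
  shows "path_component_of (top_of_set (graph_space k R))
           (tuple (map real v @ ys @ [0])) (tuple (map real v @ zs @ [0]))"
proof (rule path_component_of_segment)
  fix t :: real
  show "tuple (map2 (\<lambda>x y. (1 - t) * x + t * y) (map real v @ ys @ [0]) (map real v @ zs @ [0]))
          \<in> graph_space k R"
    using assms by (simp add: map2_interpolate_same bottom_in_graph_space)
qed (use assms in simp)

lemma graph_space_path_top:
  assumes "length w = k" "length ys = k" "length zs = k"
  shows "path_component_of (top_of_set (graph_space k R))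
           (tuple (ys @ map real w @ [1])) (tuple (zs @ map real w @ [1]))"
proof (rule path_component_of_segment)
  fix t :: real
  show "tuple (map2 (\<lambda>x y. (1 - t) * x + t * y) (ys @ map real w @ [1]) (zs @ map real w @ [1]))
          \<in> graph_space k R"
    using assms by (simp add: map2_interpolate_same top_in_graph_space)
qed (use assms in simp)

lemma graph_space_path_edge:
  assumes "(v, w) \<in> R\<^sup>=" "length v = k" "length w = k"
  shows "path_component_of (top_of_set (graph_space k R))
           (tuple (map real v @ map real w @ [0])) (tuple (map real v @ map real w @ [1]))"
proof (rule path_component_of_segment)
  fix t :: real
  assume "0 \<le> t" "t \<le> 1"
  then show "tuple (map2 (\<lambda>x y. (1 - t) * x + t * y)
               (map real v @ map real w @ [0]) (map real v @ map real w @ [1])) \<in> graph_space k R"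
    using assms by (simp add: map2_interpolate_same edge_in_graph_space)
qed simp

text \<open>Slide in the bottom slice of \<open>v\<close> until over \<open>(v, w)\<close>, climb
  the edge, slide in the top slice of \<open>w\<close> until over \<open>(w, w)\<close>, and descend
  the segment due to reflexivity.\<close>

lemma graph_space_path_step:
  assumes "(v, w) \<in> R" "length v = k" "length w = k"
  shows "path_component_of (top_of_set (graph_space k R))
           (tuple (map real v @ map real v @ [0])) (tuple (map real w @ map real w @ [0]))"
proof -
  let ?P = "path_component_of (top_of_set (graph_space k R))"
  note [trans] = path_component_of_trans
  have "?P (tuple (map real v @ map real v @ [0])) (tuple (map real v @ map real w @ [0]))"
    using assms by (intro graph_space_path_bottom) auto
  also have "?P \<dots> (tuple (map real v @ map real w @ [1]))"
    using assms by (intro graph_space_path_edge) auto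
  also have "?P \<dots> (tuple (map real w @ map real w @ [1]))"
    using assms by (intro graph_space_path_top) auto
  also have "?P \<dots> (tuple (map real w @ map real w @ [0]))"
    using assms by (intro path_component_of_sym[OF graph_space_path_edge]) auto
  finally show ?thesis .
qed

text \<open>Induction along the walk, with the diagonal points over \<open>(v, v)\<close> at height
  0 as base points. The length of \<open>v\<close> is carried along, since only the edges force
  it.\<close>

lemma graph_space_path_component:
  assumes "(u, v) \<in> (R \<union> R\<inverse>)\<^sup>*" and "R \<subseteq> {(v, w). length v = k \<and> length w = k}"
    and "length u = k" "length ys = k" "length zs = k"
  shows "path_component_of (top_of_set (graph_space k R))
           (tuple (map real u @ ys @ [0])) (tuple (map real v @ zs @ [0]))"
proof -
  let ?P = "path_component_of (top_of_set (graph_space k R))"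
  have "length v = k \<and>
      ?P (tuple (map real u @ map real u @ [0])) (tuple (map real v @ map real v @ [0]))"
    using assms(1)
  proof (induction rule: rtrancl_induct)
    case base
    then show ?case
      using assms graph_space_path_bottom[of u k "map real u" "map real u"] by simp
  next
    case (step v w)
    then have "length w = k" and "(v, w) \<in> R \<or> (w, v) \<in> R"
      using assms(2) by auto
    then have "?P (tuple (map real v @ map real v @ [0])) (tuple (map real w @ map real w @ [0]))"
      using step.IH by (metis graph_space_path_step path_component_of_sym)
    with step.IH \<open>length w = k\<close> show ?case
      by (meson path_component_of_trans)
  qed
  moreover from this have "?P (tuple (map real v @ map real v @ [0])) (tuple (map real v @ zs @ [0]))"
    using assms by (intro graph_space_path_bottom) auto
  moreover have "?P (tuple (map real u @ ys @ [0])) (tuple (map real u @ map real u @ [0]))"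
    using assms by (intro graph_space_path_bottom) auto
  ultimately show ?thesis
    by (meson path_component_of_trans)
qed

section \<open>Clopen sets separating graph components\<close>

text \<open>
  A union \<open>K\<close> of graph components cuts out a relatively open subset: strictly below height 1 the
  first block of coordinates is integral, strictly above height 0 the second one is.
\<close>

definition graph_part :: "nat \<Rightarrow> nat list set \<Rightarrow> (nat \<Rightarrow> real) set" where
  "graph_part k K =
     {x. x (2 * k) < 1 \<and> (\<exists>v\<in>K. \<forall>i<k. \<bar>x i - real (v ! i)\<bar> < 1)} \<union>
     {x. 0 < x (2 * k) \<and> (\<exists>w\<in>K. \<forall>i<k. \<bar>x (k + i) - real (w ! i)\<bar> < 1)}"

lemma open_graph_part: "open (graph_part k K)"
proof -
  have *: "continuous_on UNIV (\<lambda>x::nat \<Rightarrow> real. x j)" for j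
    by (rule continuous_on_product_coordinates)
  have "graph_part k K =
     ({x. x (2 * k) < 1} \<inter> (\<Union>v\<in>K. \<Inter>i\<in>{..<k}. {x. \<bar>x i - real (v ! i)\<bar> < 1})) \<union>
     ({x. 0 < x (2 * k)} \<inter> (\<Union>w\<in>K. \<Inter>i\<in>{..<k}. {x. \<bar>x (k + i) - real (w ! i)\<bar> < 1}))"
    by (auto simp: graph_part_def)
  also have "open \<dots>"
    by (intro open_Un open_Int open_UN ballI open_INT finite_lessThan open_Collect_less
        continuous_intros *)
  finally show ?thesis .
qed

text \<open>Distinct naturals are at distance at least 1, so an open box of radius 1 around a vertex
  contains no other vertex.\<close>

lemma near_nat_list_iff:
  assumes "length v = k" "K \<subseteq> {v. length v = k}"
  shows "(\<exists>w\<in>K. \<forall>i<k. \<bar>real (v ! i) - real (w ! i)\<bar> < 1) \<longleftrightarrow> v \<in> K"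
proof
  assume "\<exists>w\<in>K. \<forall>i<k. \<bar>real (v ! i) - real (w ! i)\<bar> < 1"
  then obtain w where w: "w \<in> K" "\<forall>i<k. \<bar>real (v ! i) - real (w ! i)\<bar> < 1"
    by blast
  then have "\<forall>i<k. v ! i = w ! i"
    by force
  then have "v = w"
    using assms w(1) by (intro nth_equalityI) auto
  with w(1) show "v \<in> K"
    by simp
qed (auto intro!: bexI[of _ v])

lemma tuple_append_blocks:
  assumes "length xs = k" "length ys = k"
  shows "i < k \<Longrightarrow> tuple (xs @ ys @ [t]) i = xs ! i"
    and "i < k \<Longrightarrow> tuple (xs @ ys @ [t]) (k + i) = ys ! i"
    and "tuple (xs @ ys @ [t]) (2 * k) = t"
  using assms by (auto simp: tuple_def nth_append)

lemma bottom_in_graph_part_iff: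
  assumes "length v = k" "length ys = k" "K \<subseteq> {v. length v = k}"
  shows "tuple (map real v @ ys @ [0]) \<in> graph_part k K \<longleftrightarrow> v \<in> K"
  using assms near_nat_list_iff[OF assms(1,3)]
  by (simp add: graph_part_def tuple_append_blocks)

lemma top_in_graph_part_iff:
  assumes "length w = k" "length ys = k" "K \<subseteq> {v. length v = k}"
  shows "tuple (ys @ map real w @ [1]) \<in> graph_part k K \<longleftrightarrow> w \<in> K"
  using assms near_nat_list_iff[OF assms(1,3)]
  by (simp add: graph_part_def tuple_append_blocks)

text \<open>Every \<open>t\<close> satisfies \<open>t < 1\<close> or \<open>0 < t\<close>, so one
  half of \<open>graph_part\<close> always applies; the halves agree because \<open>K\<close> does
  not separate \<open>v\<close> from \<open>w\<close>.\<close>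

lemma edge_in_graph_part_iff:
  assumes "length v = k" "length w = k" "K \<subseteq> {v. length v = k}" "v \<in> K \<longleftrightarrow> w \<in> K"
  shows "tuple (map real v @ map real w @ [t]) \<in> graph_part k K \<longleftrightarrow> v \<in> K"
  using assms near_nat_list_iff[OF assms(1,3)] near_nat_list_iff[OF assms(2,3)]
  by (auto simp: graph_part_def tuple_append_blocks)

text \<open>No edge leaves \<open>K\<close> or its complement, so every point of the space is sorted
  by a vertex below or above it. With both parts open, each has a clopen trace.\<close>

lemma graph_part_compl:
  assumes "K \<subseteq> {v. length v = k}" "\<And>v w. (v, w) \<in> R \<Longrightarrow> v \<in> K \<longleftrightarrow> w \<in> K"
    and "x \<in> graph_space k R"
  shows "x \<in> graph_part k ({v. length v = k} - K) \<longleftrightarrow> x \<notin> graph_part k K"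
proof -
  have compl: "{v. length v = k} - K \<subseteq> {v. length v = k}"
    by blast
  from assms(3) consider
      (bottom) v ys where "x = tuple (map real v @ ys @ [0])" "length v = k" "length ys = k"
    | (top) w ys where "x = tuple (ys @ map real w @ [1])" "length w = k" "length ys = k"
    | (edge) v w t where "x = tuple (map real v @ map real w @ [t])" "length v = k" "length w = k"
        "(v, w) \<in> R\<^sup>="
    unfolding graph_space_def by blast
  then show ?thesis
  proof cases
    case bottom
    then show ?thesis
      using bottom_in_graph_part_iff[OF bottom(2,3) assms(1)]
        bottom_in_graph_part_iff[OF bottom(2,3) compl] by blast
  next
    case top
    then show ?thesis
      using top_in_graph_part_iff[OF top(2,3) assms(1)]
        top_in_graph_part_iff[OF top(2,3) compl] by blast
  next
    case edge
    then have "v \<in> K \<longleftrightarrow> w \<in> K"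
      using assms(2) by blast
    then show ?thesis
      using edge edge_in_graph_part_iff[OF edge(2,3) assms(1)]
        edge_in_graph_part_iff[OF edge(2,3) compl] by blast
  qed
qed

text \<open>The graph component of \<open>u\<close> cuts out a clopen set, and no quasicomponent
  crosses its boundary.\<close>

lemma graph_space_quasi_component:
  assumes "quasi_component_of (top_of_set (graph_space k R))
             (tuple (map real u @ ys @ [0])) (tuple (map real v @ zs @ [0]))"
    and "R \<subseteq> {(v, w). length v = k \<and> length w = k}"
    and "length u = k" "length v = k" "length ys = k" "length zs = k"
  shows "(u, v) \<in> (R \<union> R\<inverse>)\<^sup>*"
proof -
  define K where "K = {w. length w = k \<and> (u, w) \<in> (R \<union> R\<inverse>)\<^sup>*}"
  have K: "K \<subseteq> {v. length v = k}" "\<And>v w. (v, w) \<in> R \<Longrightarrow> v \<in> K \<longleftrightarrow> w \<in> K"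
    using assms(2) by (auto simp: K_def intro: rtrancl_into_rtrancl)
  let ?E = "graph_space k R"
  let ?T = "?E \<inter> graph_part k K"
  have "openin (top_of_set ?E) ?T"
    by (simp add: openin_open_Int open_graph_part)
  \<comment> \<open>The complement is cut out by the remaining vertices, hence open as well.\<close>
  moreover have "?E - ?T = ?E \<inter> graph_part k ({v. length v = k} - K)"
    using graph_part_compl[OF K] by auto
  then have "closedin (top_of_set ?E) ?T"
    by (simp add: closedin_def openin_open_Int open_graph_part)
  moreover have "tuple (map real u @ ys @ [0]) \<in> ?T"
    using assms K(1) by (simp add: bottom_in_graph_part_iff bottom_in_graph_space) (simp add: K_def)
  ultimately have "tuple (map real v @ zs @ [0]) \<in> ?T"
    using assms(1) unfolding quasi_component_of_def by blast
  then show ?thesis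
    using assms K(1) by (simp add: bottom_in_graph_part_iff) (simp add: K_def)
qed

section \<open>Divisibility as a graph component\<close>

text \<open>
  In a vertex \<open>[n, m, r]\<close> reachable from \<open>[0, 0, 0]\<close>, the counter \<open>r\<close> is the residue of \<open>m\<close> modulo
  \<open>n\<close>, with both 0 and \<open>n\<close> standing for the zero residue.
\<close>

definition residue_step :: "(nat list \<times> nat list) set" where
  "residue_step =
     {([n, m, r], [n, Suc m, Suc r]) | n m r. r < n} \<union>
     {([n, m, n], [n, m, 0]) | n m. True} \<union>
     {([n, 0, 0], [Suc n, 0, 0]) | n. True}"

lemma residue_step_length: "residue_step \<subseteq> {(v, w). length v = 3 \<and> length w = 3}"
  by (auto simp: residue_step_def)

text \<open>The congruence survives moves in both directions: counting raises \<open>m\<close> and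
  \<open>r\<close> together, a reset changes \<open>r\<close> by \<open>n\<close>, and
  \<open>n\<close> changes only when \<open>m\<close> and \<open>r\<close> are 0. Integers avoid
  truncated subtraction.\<close>

lemma residue_step_invariant:
  assumes "([0, 0, 0], v) \<in> (residue_step \<union> residue_step\<inverse>)\<^sup>*"
  shows "\<exists>n m r. v = [n, m, r] \<and> int n dvd int m - int r"
  using assms
proof (induction rule: rtrancl_induct)
  case base
  then show ?case
    by simp
next
  case (step v w)
  \<comment> \<open>For the reset: the counter values \<open>n\<close> and 0 impose the same
    condition.\<close>
  have "int n dvd int m - int n \<longleftrightarrow> n dvd m" for n m
    by (metis dvd_minus_add dvd_refl dvd_diff_commute dvd_diff_right_iff int_dvd_int_iff)
  with step show ?case
    by (fastforce simp: residue_step_def)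
qed

text \<open>Counting is allowed while \<open>r < n\<close>, so it arrives at \<open>r = n\<close>,
  the state from which the counter is reset.\<close>

lemma residue_reachable:
  "r \<le> n \<Longrightarrow> ([n, q * n, 0], [n, q * n + r, r]) \<in> residue_step\<^sup>*"
proof (induction r)
  case (Suc r)
  moreover have "([n, q * n + r, r], [n, q * n + Suc r, Suc r]) \<in> residue_step"
    using Suc.prems by (auto simp: residue_step_def)
  ultimately show ?case
    by (simp add: rtrancl_into_rtrancl)
qed simp

text \<open>First raise \<open>n\<close> while the other entries are 0; then each round of
  \<open>n\<close> counting moves and one reset adds \<open>n\<close> to \<open>m\<close>.\<close>

lemma multiple_reachable: "([0, 0, 0], [n, q * n, 0]) \<in> residue_step\<^sup>*"
proof (induction q)
  case 0
  show ?case
  proof (induction n)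
    case (Suc n)
    moreover have "([n, 0, 0], [Suc n, 0, 0]) \<in> residue_step"
      by (auto simp: residue_step_def)
    ultimately show ?case
      by (simp add: rtrancl_into_rtrancl)
  qed simp
next
  case (Suc q)
  have "([n, q * n + n, n], [n, q * n + n, 0]) \<in> residue_step"
    by (auto simp: residue_step_def)
  with Suc residue_reachable[of n n q] have "([0, 0, 0], [n, q * n + n, 0]) \<in> residue_step\<^sup>*"
    by (meson order_refl rtrancl_into_rtrancl rtrancl_trans)
  then show ?case
    by (simp add: add.commute)
qed

lemma residue_component_iff_dvd:
  "([0, 0, 0], [n, m, 0]) \<in> (residue_step \<union> residue_step\<inverse>)\<^sup>* \<longleftrightarrow> n dvd m"
proof
  assume "([0, 0, 0], [n, m, 0]) \<in> (residue_step \<union> residue_step\<inverse>)\<^sup>*"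
  from residue_step_invariant[OF this] show "n dvd m"
    by simp
next
  assume "n dvd m"
  then obtain q where "m = q * n"
    by (metis dvd_def mult.commute)
  with multiple_reachable[of n q] show "([0, 0, 0], [n, m, 0]) \<in> (residue_step \<union> residue_step\<inverse>)\<^sup>*"
    using rtrancl_mono[of residue_step "residue_step \<union> residue_step\<inverse>"] by auto
qed

section \<open>Definability\<close>

text \<open>The formula stays the same: the fixed coordinates \<open>ps\<close> become its first
  parameters, and the old parameters \<open>c\<close> follow them in \<open>d\<close>.\<close>

lemma definable_fiber:
  assumes "definable M (n + length ps) E"
  shows "definable M n
    {x \<in> topspace (Euclidean_space n). (\<lambda>i. if i < n then x i else tuple ps (i - n)) \<in> E}"
proof -
  from assms obtain \<phi> c where wf: "wf_formula M \<phi>" and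
    E: "E = {x \<in> topspace (Euclidean_space (n + length ps)).
               satisfies M (\<lambda>i. if i < n + length ps then x i else c (i - (n + length ps))) \<phi>}"
    by (auto simp: definable_def)
  define d where "d j = (if j < length ps then ps ! j else c (j - length ps))" for j
  have "(\<lambda>i. if i < n + length ps then if i < n then x i else tuple ps (i - n)
          else c (i - (n + length ps))) = (\<lambda>i. if i < n then x i else d (i - n))" for x
    by (auto simp: d_def tuple_def fun_eq_iff diff_diff_left)
  moreover have "(\<lambda>i. if i < n then x i else tuple ps (i - n))
      \<in> topspace (Euclidean_space (n + length ps))" for x
    by (auto simp: topspace_Euclidean_space tuple_def)
  ultimately show ?thesis
    unfolding definable_def E using wf by (intro exI[of _ \<phi>] exI[of _ d]) auto
qed

text \<open>Expresses the successor on naturals using only the order and \<open>\<nat>\<close>, as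
  the language demands.\<close>

lemma between_nats_iff_Suc:
  assumes "x = real m" "y = real n"
  shows "x < y \<and> \<not> (\<exists>z. z \<in> \<nat> \<and> x < z \<and> z < y) \<longleftrightarrow> n = Suc m"
proof -
  have "(\<exists>z. z \<in> \<nat> \<and> x < z \<and> z < y) \<longleftrightarrow> (\<exists>k. m < k \<and> k < n)"
    using assms by (metis Nats_cases of_nat_in_Nats of_nat_less_iff)
  moreover have "m < n \<and> \<not> (\<exists>k. m < k \<and> k < n) \<longleftrightarrow> n = Suc m"
    by (metis Suc_lessI lessI not_less_eq)
  ultimately show ?thesis
    using assms by simp
qed

lemma length_3_iff: "length xs = 3 \<longleftrightarrow> (\<exists>a b c. xs = [a, b, c])"
  by (auto simp: length_Suc_conv numeral_3_eq_3)

text \<open>The formula \<open>Step\<close> below copies these four disjuncts.\<close>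

lemma residue_step_iff:
  "([n, m, r], [n', m', r']) \<in> residue_step\<^sup>= \<longleftrightarrow>
     n = n' \<and> m = m' \<and> r = r' \<or>
     n = n' \<and> m' = Suc m \<and> r' = Suc r \<and> r < n \<or>
     n = n' \<and> m = m' \<and> r = n \<and> r' = 0 \<or>
     n' = Suc n \<and> m = 0 \<and> r = 0 \<and> m' = 0 \<and> r' = 0"
  by (auto simp: residue_step_def)

lemma tuple_eq_iff:
  assumes "length xs = n"
  shows "x = tuple xs \<longleftrightarrow> x \<in> topspace (Euclidean_space n) \<and> (\<forall>i<n. x i = xs ! i)"
proof
  assume "x = tuple xs"
  then show "x \<in> topspace (Euclidean_space n) \<and> (\<forall>i<n. x i = xs ! i)"
    using assms by (simp add: tuple_in_Euclidean_space) (simp add: tuple_def)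
next
  assume "x \<in> topspace (Euclidean_space n) \<and> (\<forall>i<n. x i = xs ! i)"
  then show "x = tuple xs"
    using assms by (intro ext) (simp add: tuple_def topspace_Euclidean_space)
qed

lemma all_less_7: "(\<forall>i<7. P i) \<longleftrightarrow> P 0 \<and> P 1 \<and> P 2 \<and> P 3 \<and> P 4 \<and> P 5 \<and> P (6::nat)"
  by (simp add: numeral_eq_Suc All_less_Suc conj_ac)

text \<open>Trades tuples for coordinate conditions that a formula can state: 0 to 2 hold the first
  vertex, 3 to 5 the second, 6 the height.\<close>

lemma graph_space_residue_step_iff:
  "x \<in> graph_space 3 residue_step \<longleftrightarrow> x \<in> topspace (Euclidean_space 7) \<and>
     (x 6 = 0 \<and> x 0 \<in> \<nat> \<and> x 1 \<in> \<nat> \<and> x 2 \<in> \<nat> \<or>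
      x 6 = 1 \<and> x 3 \<in> \<nat> \<and> x 4 \<in> \<nat> \<and> x 5 \<in> \<nat> \<or>
      0 \<le> x 6 \<and> x 6 \<le> 1 \<and>
      (\<exists>n m r n' m' r'. x 0 = real n \<and> x 1 = real m \<and> x 2 = real r \<and>
         x 3 = real n' \<and> x 4 = real m' \<and> x 5 = real r' \<and>
         ([n, m, r], [n', m', r']) \<in> residue_step\<^sup>=))"
    (is "_ \<longleftrightarrow> ?R" is "_ \<longleftrightarrow> _ \<and> ?N")
proof
  assume x: "x \<in> graph_space 3 residue_step"
  have "x \<in> topspace (Euclidean_space 7)"
    using x unfolding graph_space_def by (auto intro!: tuple_in_Euclidean_space)
  moreover have "?N"
    using x unfolding graph_space_def Un_iff mem_Collect_eq length_3_iff
    by (elim disjE exE conjE) (simp_all add: tuple_def)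
  ultimately show "?R" ..
next
  assume R: ?R
  then have x: "x = tuple [x 0, x 1, x 2, x 3, x 4, x 5, x 6]"
    by (subst tuple_eq_iff[where n = 7]) (simp_all add: all_less_7)
  from R consider
      (bottom) n m r where "x 0 = real n" "x 1 = real m" "x 2 = real r" "x 6 = 0"
    | (top) n m r where "x 3 = real n" "x 4 = real m" "x 5 = real r" "x 6 = 1"
    | (edge) n m r n' m' r' where "x 0 = real n" "x 1 = real m" "x 2 = real r"
        "x 3 = real n'" "x 4 = real m'" "x 5 = real r'" "0 \<le> x 6" "x 6 \<le> 1"
        "([n, m, r], [n', m', r']) \<in> residue_step\<^sup>="
    by (elim conjE disjE exE Nats_cases) blast+
  then show "x \<in> graph_space 3 residue_step"
  proof cases
    case bottom
    then show ?thesis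
      using x bottom_in_graph_space[of "[n, m, r]" 3 "[x 3, x 4, x 5]"] by simp
  next
    case top
    then show ?thesis
      using x top_in_graph_space[of "[n, m, r]" 3 "[x 0, x 1, x 2]"] by simp
  next
    case edge
    then show ?thesis
      using x edge_in_graph_space[of "[n, m, r]" 3 "[n', m', r']" residue_step "x 6"] by simp
  qed
qed

text \<open>Variables 7 and 8 carry the parameters 0 and 1; variable 9 is bound.\<close>

lemma definable_graph_space_residue_step:
  fixes M :: "('f, 'r) real_structure"
  assumes "expands_order_nat M"
  shows "definable M 7 (graph_space 3 residue_step)"
proof -
  obtain less nat where sym: "less \<in> rel_syms M" "rel_arity M less = 2"
      "nat \<in> rel_syms M" "rel_arity M nat = 1"
    and less: "\<And>x y. rel_interp M less [x, y] \<longleftrightarrow> x < y"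
    and nat: "\<And>x. rel_interp M nat [x] \<longleftrightarrow> x \<in> \<nat>"
    using assms by (auto simp: expands_order_nat_def)
  define Lt :: "nat \<Rightarrow> nat \<Rightarrow> ('f, 'r) fo_formula" where "Lt i j = Rel less [Var i, Var j]" for i j
  define Nat :: "nat \<Rightarrow> ('f, 'r) fo_formula" where "Nat i = Rel nat [Var i]" for i
  define Same :: "nat \<Rightarrow> nat \<Rightarrow> ('f, 'r) fo_formula" where "Same i j = Eq (Var i) (Var j)" for i j
  define Or where "Or a b = Neg (Conj (Neg a) (Neg b))" for a b :: "('f, 'r) fo_formula"
  define Succ where
    "Succ i j = Conj (Lt i j) (Neg (Ex 9 (Conj (Nat 9) (Conj (Lt i 9) (Lt 9 j)))))" for i j
  define Step where "Step =
    Or (Conj (Same 0 3) (Conj (Same 1 4) (Same 2 5)))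
      (Or (Conj (Same 0 3) (Conj (Succ 1 4) (Conj (Succ 2 5) (Lt 2 0))))
        (Or (Conj (Same 0 3) (Conj (Same 1 4) (Conj (Same 2 0) (Same 5 7))))
          (Conj (Succ 0 3) (Conj (Same 1 7) (Conj (Same 2 7) (Conj (Same 4 7) (Same 5 7)))))))"
  define \<phi> where "\<phi> =
    Or (Conj (Same 6 7) (Conj (Nat 0) (Conj (Nat 1) (Nat 2))))
      (Or (Conj (Same 6 8) (Conj (Nat 3) (Conj (Nat 4) (Nat 5))))
        (Conj (Conj (Neg (Lt 6 7)) (Neg (Lt 8 6)))
          (Conj (Conj (Nat 0) (Conj (Nat 1) (Nat 2)))
            (Conj (Conj (Nat 3) (Conj (Nat 4) (Nat 5))) Step))))"
  define c :: "nat \<Rightarrow> real" where "c k = (if k = 0 then 0 else 1)" for k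
  note fo_defs = Lt_def Nat_def Same_def Or_def Succ_def Step_def \<phi>_def
  have "wf_formula M \<phi>"
    by (simp add: fo_defs sym)
  have sat [simp]: "satisfies M v (Lt i j) \<longleftrightarrow> v i < v j" "satisfies M v (Nat i) \<longleftrightarrow> v i \<in> \<nat>"
    "satisfies M v (Same i j) \<longleftrightarrow> v i = v j"
    "satisfies M v (Or a b) \<longleftrightarrow> satisfies M v a \<or> satisfies M v b" for v i j a b
    by (simp_all add: fo_defs less nat)
  \<comment> \<open>The bound variable 9 must not capture \<open>i\<close> or
    \<open>j\<close>.\<close>
  have Succ: "satisfies M v (Succ i j) \<longleftrightarrow> n = Suc m"
    if "v i = real m" "v j = real n" "i \<noteq> 9" "j \<noteq> 9" for v i j m n
    using between_nats_iff_Suc[OF that(1,2)] that(3,4) by (simp add: Succ_def)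
  have Step: "satisfies M v Step \<longleftrightarrow> ([n, m, r], [n', m', r']) \<in> residue_step\<^sup>="
    if "v 0 = real n" "v 1 = real m" "v 2 = real r" "v 3 = real n'" "v 4 = real m'" "v 5 = real r'"
      "v 7 = 0" for v n m r n' m' r'
    unfolding Step_def residue_step_iff
    using that Succ[of v 1 m 4 m'] Succ[of v 2 r 5 r'] Succ[of v 0 n 3 n'] by auto
  have "satisfies M v \<phi> \<longleftrightarrow>
     (v 6 = 0 \<and> v 0 \<in> \<nat> \<and> v 1 \<in> \<nat> \<and> v 2 \<in> \<nat> \<or>
      v 6 = 1 \<and> v 3 \<in> \<nat> \<and> v 4 \<in> \<nat> \<and> v 5 \<in> \<nat> \<or>
      0 \<le> v 6 \<and> v 6 \<le> 1 \<and>
      (\<exists>n m r n' m' r'. v 0 = real n \<and> v 1 = real m \<and> v 2 = real r \<and>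
         v 3 = real n' \<and> v 4 = real m' \<and> v 5 = real r' \<and>
         ([n, m, r], [n', m', r']) \<in> residue_step\<^sup>=))"
    if v: "v 7 = 0" "v 8 = 1" for v
  proof -
    \<comment> \<open>\<open>Step\<close> has its intended meaning only at natural arguments, hence
      the membership conditions in front of it.\<close>
    have "v 0 \<in> \<nat> \<and> v 1 \<in> \<nat> \<and> v 2 \<in> \<nat> \<and> v 3 \<in> \<nat> \<and> v 4 \<in> \<nat> \<and> v 5 \<in> \<nat> \<and> satisfies M v Step \<longleftrightarrow>
      (\<exists>n m r n' m' r'. v 0 = real n \<and> v 1 = real m \<and> v 2 = real r \<and>
         v 3 = real n' \<and> v 4 = real m' \<and> v 5 = real r' \<and>
         ([n, m, r], [n', m', r']) \<in> residue_step\<^sup>=)" (is "?L \<longleftrightarrow> ?R")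
    proof
      assume ?L
      then obtain n m r n' m' r' where "v 0 = real n" "v 1 = real m" "v 2 = real r"
        "v 3 = real n'" "v 4 = real m'" "v 5 = real r'"
        by (elim conjE Nats_cases)
      with \<open>?L\<close> Step v(1) show ?R
        by metis
    next
      assume ?R
      then obtain n m r n' m' r' where *: "v 0 = real n" "v 1 = real m" "v 2 = real r"
        "v 3 = real n'" "v 4 = real m'" "v 5 = real r'"
        and "([n, m, r], [n', m', r']) \<in> residue_step\<^sup>="
        by (elim exE conjE)
      then have "satisfies M v Step"
        using Step[OF * v(1)] by blast
      with * show ?L
        by simp
    qed
    with v show ?thesis
      by (simp add: \<phi>_def not_less)
  qed
  then have "graph_space 3 residue_step = {x \<in> topspace (Euclidean_space 7).
      satisfies M (\<lambda>i. if i < 7 then x i else c (i - 7)) \<phi>}"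
    by (simp add: set_eq_iff graph_space_residue_step_iff c_def)
  with \<open>wf_formula M \<phi>\<close> show ?thesis
    unfolding definable_def by blast
qed

section \<open>From one definable component to divisibility\<close>

text \<open>\<open>P\<close> stands for any of the three component relations. Paths give the points
  that \<open>P\<close> must reach, clopen sets those it cannot reach, and both bounds coincide with
  graph reachability.\<close>

lemma definable_component_imp_definable_dvd:
  assumes "definable M 7 (Collect (P (tuple [0, 0, 0, 0, 0, 0, 0])))"
    and component: "\<And>x y. path_component_of (top_of_set (graph_space 3 residue_step)) x y \<Longrightarrow> P x y"
      "\<And>x y. P x y \<Longrightarrow> quasi_component_of (top_of_set (graph_space 3 residue_step)) x y"
  shows "definable M 2 {tuple [real n, real (d * n)] | n d :: nat. True}"
proof -
  let ?O = "tuple [0, 0, 0, 0, 0, 0, 0]"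
  have P_iff: "P ?O (tuple [real n, real m, 0, 0, 0, 0, 0]) \<longleftrightarrow> n dvd m" for n m
    using residue_component_iff_dvd[of n m] residue_step_length component
      graph_space_path_component[of "[0, 0, 0]" "[n, m, 0]" residue_step 3 "[0, 0, 0]" "[0, 0, 0]"]
      graph_space_quasi_component[of 3 residue_step "[0, 0, 0]" "[0, 0, 0]" "[n, m, 0]" "[0, 0, 0]"]
    by auto
  \<comment> \<open>At height 0 the space contains this point only if its first block is integral or
    it lies on an edge; \<open>x\<close> and \<open>y\<close> are natural in both cases.\<close>
  have Nats: "x \<in> \<nat> \<and> y \<in> \<nat>" if "P ?O (tuple [x, y, 0, 0, 0, 0, 0])" for x y
  proof -
    have "tuple [x, y, 0, 0, 0, 0, 0] \<in> graph_space 3 residue_step"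
      using quasi_component_of_refl quasi_component_in_topspace[OF component(2)[OF that]] by auto
    then show ?thesis
      by (auto simp: graph_space_residue_step_iff tuple_def)
  qed
  \<comment> \<open>The five fixed zeros are the counter \<open>r\<close>, the free second block,
    and the height.\<close>
  have "definable M 2 {x \<in> topspace (Euclidean_space 2).
      (\<lambda>i. if i < 2 then x i else tuple [0, 0, 0, 0, 0] (i - 2)) \<in> Collect (P ?O)}"
    using assms(1) by (intro definable_fiber) simp
  also have "{x \<in> topspace (Euclidean_space 2).
      (\<lambda>i. if i < 2 then x i else tuple [0, 0, 0, 0, 0] (i - 2)) \<in> Collect (P ?O)} =
    {tuple [real n, real (d * n)] | n d :: nat. True}" (is "?L = ?R")
  proof -
    have pair: "x = tuple [a, b] \<longleftrightarrow> x \<in> topspace (Euclidean_space 2) \<and> x 0 = a \<and> x 1 = b" for x a b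
      by (subst tuple_eq_iff[where n = 2]) (auto simp: less_2_cases_iff)
    have ext: "(\<lambda>i. if i < 2 then x i else tuple [0, 0, 0, 0, 0] (i - 2)) =
        tuple [x 0, x 1, 0, 0, 0, 0, 0]" for x
      by (auto simp: fun_eq_iff tuple_def nth_Cons' less_2_cases_iff)
    show ?thesis
    proof (intro equalityI subsetI)
      fix x
      assume "x \<in> ?L"
      then have x: "x \<in> topspace (Euclidean_space 2)" "P ?O (tuple [x 0, x 1, 0, 0, 0, 0, 0])"
        by (simp_all add: ext)
      with Nats obtain n m where nm: "x 0 = real n" "x 1 = real m"
        by (meson Nats_cases)
      with x P_iff obtain d where "m = d * n"
        by (metis dvd_def mult.commute)
      with x nm show "x \<in> ?R"
        by (auto simp: pair)
    next
      fix x
      assume "x \<in> ?R"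
      then obtain n d where "x = tuple [real n, real (d * n)]"
        by blast
      then have "x \<in> topspace (Euclidean_space 2)" "x 0 = real n" "x 1 = real (d * n)"
        by (simp_all only: pair)
      then show "x \<in> ?L"
        by (simp add: ext P_iff del: of_nat_mult)
    qed
  qed
  finally show ?thesis .
qed

theorem proposition1p5:
  fixes M :: "('f, 'r) real_structure"
  assumes "expands_order_nat M"
    and "PCC M \<or> CC M \<or> QCC M"
  shows "definable M 2 {tuple [real n, real (d * n)] | n d :: nat. True}"
proof -
  let ?E = "graph_space 3 residue_step" and ?O = "tuple [0, 0, 0, 0, 0, 0, 0]"
  have def_E: "definable M 7 ?E"
    using assms(1) by (rule definable_graph_space_residue_step)
  have "?E \<subseteq> topspace (Euclidean_space 7)"
    by (auto simp: graph_space_residue_step_iff)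
  then have top_E: "subtopology (Euclidean_space 7) ?E = top_of_set ?E"
    by (rule subtopology_Euclidean_space)
  have "?O \<in> topspace (top_of_set ?E)"
    using bottom_in_graph_space[of "[0, 0, 0]" 3 "[0, 0, 0]"] by simp
  with assms(2) def_E
  have "definable M 7 (Collect (path_component_of (top_of_set ?E) ?O)) \<or>
      definable M 7 (Collect (connected_component_of (top_of_set ?E) ?O)) \<or>
      definable M 7 (Collect (quasi_component_of (top_of_set ?E) ?O))"
    unfolding PCC_def CC_def QCC_def path_components_of_def connected_components_of_def
      quasi_components_of_def
    by (metis imageI top_E)
  then show ?thesis
    \<comment> \<open>Path components lie in connected components, and these in quasicomponents, so
      each relation fits between the two bounds.\<close>
    by (elim disjE; elim definable_component_imp_definable_dvd)
      (blast intro: path_imp_connected_component_of connected_imp_quasi_component_of)+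
qed

end
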